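(* Let $f_1,\dots,f_n:\mathbb{R}^p\to\mathbb{R}$ be twice differentiable and $F(\mathbf{x})=\frac1n\sum_{i=1}^n f_i(\mathbf{x})$. Assume that there are constants $0<K_i<\infty$ with $0\preceq\nabla^2 f_i(\mathbf{x})\preceq K_i\mathbb{I}$ for all $\mathbf{x}\in\mathbb{R}^p$ and $i=1,\dots,n$, and let $0<K<\infty$ be a constant with $\nabla^2F(\mathbf{x})\preceq K\mathbb{I}$ for all $\mathbf{x}\in\mathbb{R}^p$. Let $0<\theta_2<1$, $0<\beta<1$, $\widehat\alpha\ge1$, $\lambda>0$ be given. For any $\mathbf{x}^{(k)}\in\mathbb{R}^p$, let $\mathbf{x}^{(k+1)}$ be obtained from $\mathbf{x}^{(k)}$ by one iteration of the ridge-regularized sub-sampled Newton algorithm described in the context, with arbitrary sample size $|\mathcal{S}|\ge1$, sampling without replacement, and inexact update with tolerances $\theta_1,\theta_2$. If $$\theta_1\le\frac12\sqrt{\frac{\lambda}{\widehat K_{|\mathcal{S}|}+\lambda}},$$ then $$F(\mathbf{x}^{(k+1)})\le F(\mathbf{x}^{(k)})-\frac{\alpha_k\beta}{2\big(\widehat K_{|\mathcal{S}|}+\lambda\big)}\|\nabla F(\mathbf{x}^{(k)})\|^2.$$ If, in addition, there is a constant $0<\gamma\le K$ with $\gamma\mathbb{I}\preceq\nabla^2F(\mathbf{x})$ for all $\mathbf{x}\in\mathbb{R}^p$, then, with $\mathbf{x}^*$ the minimizer of $F$, $$F(\mathbf{x}^{(k+1)})-F(\mathbf{x}^* )\le(1-\rho)\big(F(\mathbf{x}^{(k)})-F(\mathbf{x}^*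 )\big),\qquad\rho=\frac{\alpha_k\beta\gamma}{\widehat K_{|\mathcal{S}|}+\lambda}.$$ Moreover, in both cases, the step size is at least $$\alpha_k\ge\frac{2(1-\theta_2)(1-\beta)\lambda}{K}.$$
   Context: For an integer $1\le q\le n$, $\widehat K_q$ is the average of the $q$ largest values among $K_1,\dots,K_n$. Algorithm (one iteration). A collection $\mathcal{S}$ of $|\mathcal{S}|\ge1$ indices is drawn from $\{1,\dots,n\}$ uniformly at random without replacement, $H(\mathbf{x}^{(k)})=\frac1{|\mathcal{S}|}\sum_{j\in\mathcal{S}}\nabla^2f_j(\mathbf{x}^{(k)})$, and $\hat H(\mathbf{x}^{(k)})=H(\mathbf{x}^{(k)})+\lambda\mathbb{I}$. Then $\mathbf{x}^{(k+1)}=\mathbf{x}^{(k)}+\alpha_k\mathbf{p}_k$, where, for a tolerance $\theta_1\ge0$, $\mathbf{p}_k$ is any vector satisfying both $$\|\hat H(\mathbf{x}^{(k)})\mathbf{p}_k+\nabla F(\mathbf{x}^{(k)})\|\le\theta_1\|\nabla F(\mathbf{x}^{(k)})\|,\qquad \mathbf{p}_k^T\nabla F(\mathbf{x}^{(k)})\le-(1-\theta_2)\,\mathbf{p}_k^T\hat H(\mathbf{x}^{(k)})\mathbf{p}_k,$$ and $\alpha_k$ is the largest $\alpha\le\widehat\alpha$ such that $F(\mathbf{x}^{(k)}+\alpha\mathbf{p}_k)\le F(\mathbf{x}^{(k)})+\alpha\beta\,\mathbf{p}_k^T\nabla F(\mathbf{x}^{(k)})$. $A\preceq B$ means $B-A$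 is symmetric positive semi-definite.
   Formalization: The step-size bound is proved as α_k ≥ min(α̂, 2(1−θ_2)(1−β)λ/K): since α_k ≤ α̂ by construction, the uncapped bound fails whenever it exceeds α̂ (e.g. F(x)=|x|²/2, K=1, λ=10, θ_2=β=0.1, α̂=1). *)

theory Defs
  imports "HOL-Analysis.Analysis" "HOL-Probability.Probability"
begin

definition grad :: "(real^'p \<Rightarrow> real) \<Rightarrow> real^'p \<Rightarrow> real^'p" where
  "grad f x = (THE D. GDERIV f x :> D)"

definition hessian :: "(real^'p \<Rightarrow> real) \<Rightarrow> real^'p \<Rightarrow> real^'p^'p" where
  "hessian f x = jacobian (grad f) (at x)"

definition twice_differentiable :: "(real^'p \<Rightarrow> real) \<Rightarrow> bool" where
  "twice_differentiable f \<longleftrightarrow>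
     (\<forall>x. f differentiable (at x)) \<and> (\<forall>x. grad f differentiable (at x))"

definition loewner_le :: "real^'p^'p \<Rightarrow> real^'p^'p \<Rightarrow> bool" (infix "\<preceq>" 50) where
  "A \<preceq> B \<longleftrightarrow> transpose (B - A) = B - A \<and> (\<forall>v. 0 \<le> v \<bullet> ((B - A) *v v))"

definition avg_largest :: "nat \<Rightarrow> (nat \<Rightarrow> real) \<Rightarrow> nat \<Rightarrow> real" where
  "avg_largest n K q = sum_list (take q (rev (sort (map K [1..<Suc n])))) / real q"

definition finite_avg :: "nat \<Rightarrow> (nat \<Rightarrow> real^'p \<Rightarrow> real) \<Rightarrow> real^'p \<Rightarrow> real" where
  "finite_avg n f x = (1 / real n) * (\<Sum>i=1..n. f i x)"

text \<open>A sample of size s drawn without replacement is a uniformly random s-element subset;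
  the distribution is meaningful only for s at most n.\<close>

definition sample_without_replacement :: "nat \<Rightarrow> nat \<Rightarrow> nat set pmf" where
  "sample_without_replacement n s = pmf_of_set {S. S \<subseteq> {1..n} \<and> card S = s}"

definition subsampled_hessian :: "(nat \<Rightarrow> real^'p \<Rightarrow> real) \<Rightarrow> nat set \<Rightarrow> real^'p \<Rightarrow> real^'p^'p" where
  "subsampled_hessian f S x = (1 / real (card S)) *\<^sub>R (\<Sum>j\<in>S. hessian (f j) x)"

text \<open>The matrix \<^term>\<open>mat c\<close> is the scalar matrix, c times the identity.\<close>

definition ridge_hessian ::
    "(nat \<Rightarrow> real^'p \<Rightarrow> real) \<Rightarrow> real \<Rightarrow> nat set \<Rightarrow> real^'p \<Rightarrow> real^'p^'p" where
  "ridge_hessian f lam S x = subsampled_hessian f S x + mat lam"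

definition inexact_newton_direction ::
    "(real^'p \<Rightarrow> real) \<Rightarrow> real^'p^'p \<Rightarrow> real \<Rightarrow> real \<Rightarrow> real^'p \<Rightarrow> real^'p \<Rightarrow> bool" where
  "inexact_newton_direction F Hh \<theta>1 \<theta>2 x p \<longleftrightarrow>
     norm (Hh *v p + grad F x) \<le> \<theta>1 * norm (grad F x) \<and>
     p \<bullet> grad F x \<le> - (1 - \<theta>2) * (p \<bullet> (Hh *v p))"

definition armijo ::
    "(real^'p \<Rightarrow> real) \<Rightarrow> real \<Rightarrow> real^'p \<Rightarrow> real^'p \<Rightarrow> real \<Rightarrow> bool" where
  "armijo F \<beta> x p a \<longleftrightarrow> F (x + a *\<^sub>R p) \<le> F x + a * \<beta> * (p \<bullet> grad F x)"

text \<open>The condition holds for step 0, so the largest step is nonnegative whenever the cap is.\<close>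

definition armijo_step ::
    "(real^'p \<Rightarrow> real) \<Rightarrow> real \<Rightarrow> real \<Rightarrow> real^'p \<Rightarrow> real^'p \<Rightarrow> real \<Rightarrow> bool" where
  "armijo_step F \<beta> \<alpha>max x p \<alpha> \<longleftrightarrow>
     \<alpha> \<le> \<alpha>max \<and> armijo F \<beta> x p \<alpha> \<and> (\<forall>a\<le>\<alpha>max. armijo F \<beta> x p a \<longrightarrow> a \<le> \<alpha>)"

text \<open>One iteration is a relation, for a given realization S of the random sample, because
  the direction p is any vector meeting the two inexactness conditions.\<close>

definition ssn_iteration ::
    "nat \<Rightarrow> (nat \<Rightarrow> real^'p \<Rightarrow> real) \<Rightarrow> real \<Rightarrow> real \<Rightarrow> real \<Rightarrow> real \<Rightarrow> real \<Rightarrow> nat set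
      \<Rightarrow> real^'p \<Rightarrow> real^'p \<Rightarrow> real \<Rightarrow> real^'p \<Rightarrow> bool" where
  "ssn_iteration n f lam \<theta>1 \<theta>2 \<beta> \<alpha>max S x p \<alpha> x' \<longleftrightarrow>
     inexact_newton_direction (finite_avg n f) (ridge_hessian f lam S x) \<theta>1 \<theta>2 x p \<and>
     armijo_step (finite_avg n f) \<beta> \<alpha>max x p \<alpha> \<and>
     x' = x + \<alpha> *\<^sub>R p"

end

theory Submission
  imports Defs
begin

text \<open>
  Write \<open>H\<close> for the ridge Hessian, \<open>g\<close> for the gradient and \<open>M\<close> for the sum of the average of the
  largest constants and \<open>lam\<close>, so that the quadratic form of \<open>H\<close> lies between \<open>lam\<close> and \<open>M\<close>.
  With \<open>H u = g\<close> and \<open>q = g \<bullet> u\<close>, symmetry gives \<open>p \<bullet> g = (H p + g) \<bullet> u - q\<close>, where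
  \<open>lam * norm u ^ 2 \<le> q\<close> and \<open>norm g ^ 2 \<le> M * q\<close>; the bound on \<open>\<theta>1\<close> is exactly what makes the first
  summand at most \<open>q / 2\<close>. Hence \<open>p \<bullet> g \<le> - norm g ^ 2 / (2 * M)\<close>, and the Armijo condition gives the
  first claim. Second-order Taylor expansion gives the rest: strong convexity yields the
  Polyak-Lojasiewicz inequality, and the upper Hessian bound makes every step up to
  \<open>2 * (1 - \<theta>2) * (1 - \<beta>) * lam / K\<close> satisfy the Armijo condition.
\<close>

section \<open>Sums of the largest values of a finite family\<close>

text \<open>Greedy exchange along the list: some element of \<open>M\<close> is at most the head and
  can be removed so that the rest lies in the tail. It is the head itself if \<open>M\<close>
  contains it, and any element otherwise.\<close>

lemma sum_mset_le_sum_take: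
  fixes xs :: "real list"
  assumes "sorted_wrt (\<ge>) xs" "M \<subseteq># mset xs"
  shows "sum_mset M \<le> sum_list (take (size M) xs)"
  using assms
proof (induction xs arbitrary: M)
  case Nil
  then show ?case by simp
next
  case (Cons a xs)
  show ?case
  proof (cases "M = {#}")
    case False
    have "\<exists>m. m \<in># M \<and> m \<le> a \<and> M - {#m#} \<subseteq># mset xs"
    proof (cases "a \<in># M")
      case True
      moreover have "M - {#a#} \<subseteq># mset xs"
        using Cons.prems(2) by (simp add: subset_eq_diff_conv)
      ultimately show ?thesis by blast
    next
      case notin: False
      obtain m where m: "m \<in># M" using False by blast
      have sub: "M \<subseteq># mset xs"
        using Cons.prems(2) notin by (metis diff_single_trivial mset.simps(2) subset_eq_diff_conv add_mset_add_single)
      then have "m \<in> set xs" using m mset_subset_eqD by fastforce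
      then have "m \<le> a" using Cons.prems(1) by simp
      moreover have "M - {#m#} \<subseteq># mset xs"
        using sub by (meson diff_subset_eq_self subset_mset.order_trans)
      ultimately show ?thesis using m by blast
    qed
    then obtain m where m: "m \<in># M" "m \<le> a" "M - {#m#} \<subseteq># mset xs" by blast
    then obtain M' where M': "M = add_mset m M'" by (metis multi_member_split)
    have "sum_mset M' \<le> sum_list (take (size M') xs)"
      using Cons.IH[of M'] Cons.prems(1) m(3) M' by simp
    then show ?thesis using m(2) M' by simp
  qed simp
qed

text \<open>Sampling without replacement enters here: \<open>S\<close> is a set, so each index
  contributes its constant once. Multisets are used because distinct indices may carry equal
  constants.\<close>

lemma avg_le_avg_largest:
  assumes "S \<subseteq> {1..n}"
  shows "(\<Sum>j\<in>S. K j) / real (card S) \<le> avg_largest n K (card S)"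
proof -
  let ?xs = "rev (sort (map K [1..<Suc n]))"
  have "image_mset K (mset_set S) \<subseteq># image_mset K (mset_set {1..n})"
    using assms by (intro image_mset_subseteq_mono) (simp add: subset_imp_msubset_mset_set)
  moreover have "mset ?xs = image_mset K (mset_set {1..n})"
    by (simp add: atLeastLessThanSuc_atLeastAtMost del: upt_Suc)
  moreover have "sorted_wrt (\<ge>) ?xs"
    using sorted_sort by (simp add: sorted_wrt_rev del: upt_Suc)
  ultimately have "sum_mset (image_mset K (mset_set S)) \<le> sum_list (take (card S) ?xs)"
    using sum_mset_le_sum_take[of ?xs "image_mset K (mset_set S)"] by simp
  then show ?thesis
    unfolding avg_largest_def by (intro divide_right_mono) (simp_all add: sum_unfold_sum_mset)
qed

section \<open>Quadratic forms of symmetric matrices\<close>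

lemma mat_mult_vec: "mat c *v v = c *\<^sub>R (v :: real^'p)"
  by (simp add: vec_eq_iff mat_def matrix_vector_mult_def if_distrib[of "\<lambda>a. a * _"] cong: if_cong)

lemma loewner_le_inner:
  assumes "A \<preceq> B"
  shows "v \<bullet> (A *v v) \<le> v \<bullet> (B *v v)"
  using assms by (simp add: loewner_le_def matrix_vector_mult_diff_rdistrib inner_diff_right)

lemma inner_mat_mult_vec: "v \<bullet> (mat c *v v) = c * (norm v)\<^sup>2"
  by (simp add: mat_mult_vec power2_norm_eq_inner)

lemma symmetric_inner_commute:
  fixes A :: "real^'p^'p"
  assumes "transpose A = A"
  shows "v \<bullet> (A *v w) = (A *v v) \<bullet> w"
  by (metis assms dot_lmul_matrix transpose_matrix_vector)

text \<open>The form at \<open>v + t *\<^sub>R w\<close> is a nonnegative polynomial in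
  \<open>t\<close> of degree at most two, which forces the discriminant inequality.\<close>

lemma psd_cauchy_schwarz:
  fixes A :: "real^'p^'p"
  assumes sym: "transpose A = A" and psd: "\<And>v. 0 \<le> v \<bullet> (A *v v)"
  shows "(v \<bullet> (A *v w))\<^sup>2 \<le> (v \<bullet> (A *v v)) * (w \<bullet> (A *v w))"
proof -
  define a b c where "a = v \<bullet> (A *v v)" "b = v \<bullet> (A *v w)" "c = w \<bullet> (A *v w)"
  have wv: "w \<bullet> (A *v v) = b"
    using symmetric_inner_commute[OF sym, of w v] by (simp add: a_b_c_def inner_commute)
  have poly: "0 \<le> a + 2 * t * b + t\<^sup>2 * c" for t
    using psd[of "v + t *\<^sub>R w"] wv
    by (simp add: a_b_c_def matrix_vector_right_distrib matrix_vector_mult_scaleR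
        inner_add_left inner_add_right algebra_simps power2_eq_square)
  have "c \<ge> 0" using psd a_b_c_def by blast
  have "b\<^sup>2 \<le> a * c"
  proof (cases "c = 0")
    case True
    have "b = 0"
    proof (rule ccontr)
      assume "b \<noteq> 0"
      \<comment> \<open>For \<open>c = 0\<close> the polynomial is affine in \<open>t\<close>; this
        \<open>t\<close> makes its value -1.\<close>
      then have "2 * (- (a + 1) / (2 * b)) * b = - (a + 1)" by simp
      then show False using poly[of "- (a + 1) / (2 * b)"] True by simp
    qed
    then show ?thesis using True by simp
  next
    case False
    \<comment> \<open>The choice \<open>- b / c\<close> is the minimizer of the polynomial.\<close>
    then show ?thesis using poly[of "- b / c"] \<open>c \<ge> 0\<close>
      by (simp add: power2_eq_square field_simps)
  qed
  then show ?thesis by (simp add: a_b_c_def)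
qed

text \<open>Cauchy-Schwarz for the form of \<open>A\<close>, applied to \<open>A *v u\<close> and
  \<open>u\<close>, followed by cancelling one factor \<open>(norm (A *v u))\<^sup>2\<close>. No
  eigenvalues are involved.\<close>

lemma psd_norm_mult_le:
  fixes A :: "real^'p^'p"
  assumes sym: "transpose A = A" and psd: "\<And>v. 0 \<le> v \<bullet> (A *v v)"
    and le: "\<And>v. v \<bullet> (A *v v) \<le> M * (norm v)\<^sup>2"
  shows "(norm (A *v u))\<^sup>2 \<le> M * (u \<bullet> (A *v u))"
proof (cases "A *v u = 0")
  case False
  let ?g = "A *v u"
  have "(?g \<bullet> ?g)\<^sup>2 \<le> (?g \<bullet> (A *v ?g)) * (u \<bullet> ?g)"
    using psd_cauchy_schwarz[OF sym psd, of ?g u] .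
  also have "\<dots> \<le> M * (norm ?g)\<^sup>2 * (u \<bullet> ?g)"
    by (intro mult_right_mono le psd)
  finally have "(norm ?g)\<^sup>2 * (norm ?g)\<^sup>2 \<le> (norm ?g)\<^sup>2 * (M * (u \<bullet> ?g))"
    unfolding power2_norm_eq_inner by (simp only: power2_eq_square mult_ac)
  then show ?thesis using False by (elim mult_left_le_imp_le) simp
qed simp

lemma inexact_newton_descent:
  fixes A :: "real^'p^'p"
  assumes sym: "transpose A = A"
    and lower: "\<And>v. lam * (norm v)\<^sup>2 \<le> v \<bullet> (A *v v)"
    and upper: "\<And>v. v \<bullet> (A *v v) \<le> M * (norm v)\<^sup>2"
    and pos: "0 < lam" "0 < M"
    and res: "norm (A *v p + g) \<le> \<theta> * norm g"
    and \<theta>: "\<theta> \<le> 1 / 2 * sqrt (lam / M)"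
  shows "p \<bullet> g \<le> - (norm g)\<^sup>2 / (2 * M)"
proof -
  have psd: "0 \<le> v \<bullet> (A *v v)" for v
    using lower[of v] pos by (meson order_trans mult_nonneg_nonneg less_imp_le zero_le_power2)
  \<comment> \<open>Positive definiteness gives a trivial kernel, hence surjectivity in finite
    dimension; the vector \<open>u\<close> then stands in for the inverse of \<open>A\<close>
    applied to \<open>g\<close>.\<close>
  have "inj ((*v) A)"
  proof (rule injI)
    fix v w assume "A *v v = A *v w"
    then have "lam * (norm (v - w))\<^sup>2 \<le> 0"
      using lower[of "v - w"] by (simp add: matrix_vector_mult_diff_distrib)
    then show "v = w" using pos by (simp add: mult_le_0_iff)
  qed
  then obtain u where u: "A *v u = g"
    by (metis linear_injective_imp_surjective matrix_vector_mul_linear surjD)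
  define q where "q = u \<bullet> g"
  have lu: "lam * (norm u)\<^sup>2 \<le> q" using lower[of u] u by (simp add: q_def)
  have gM: "(norm g)\<^sup>2 \<le> M * q"
    using psd_norm_mult_le[OF sym psd upper, of u] u by (simp add: q_def)
  have q0: "0 \<le> q" using psd[of u] u by (simp add: q_def)
  \<comment> \<open>Both norms are bounded through \<open>q\<close>, so that the factor
    \<open>sqrt (lam / M)\<close> from the tolerance cancels \<open>lam\<close> and \<open>M\<close>
    and leaves a multiple of \<open>q\<close>.\<close>
  have nu: "norm u \<le> sqrt (q / lam)"
    using lu pos by (intro real_le_rsqrt) (simp add: field_simps)
  have ng: "norm g \<le> sqrt (M * q)"
    using gM by (intro real_le_rsqrt)
  have "p \<bullet> g = (A *v p) \<bullet> u"
    using symmetric_inner_commute[OF sym, of p u] u by simp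
  also have "\<dots> = (A *v p + g) \<bullet> u - q"
    by (simp add: inner_add_left q_def inner_commute[of u g])
  also have "(A *v p + g) \<bullet> u \<le> norm (A *v p + g) * norm u"
    by (rule norm_cauchy_schwarz)
  also have "\<dots> \<le> \<theta> * norm g * norm u"
    by (intro mult_right_mono res) simp
  also have "\<dots> \<le> 1 / 2 * sqrt (lam / M) * norm g * norm u"
    by (intro mult_right_mono \<theta>) simp_all
  also have "\<dots> \<le> 1 / 2 * sqrt (lam / M) * sqrt (M * q) * sqrt (q / lam)"
    using pos q0 by (intro mult_mono nu ng order_refl) simp_all
  also have "\<dots> = q / 2"
    using pos q0 by (simp add: real_sqrt_mult real_sqrt_divide)
  finally have "p \<bullet> g \<le> - q / 2" by simp
  moreover have "(norm g)\<^sup>2 / (2 * M) \<le> q / 2"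
    using gM pos by (simp add: field_simps)
  ultimately show ?thesis by simp
qed

section \<open>Gradients and second-order expansion\<close>

lemma gderiv_unique:
  assumes "GDERIV f x :> D" "GDERIV f x :> D'"
  shows "D = D'"
proof -
  have "(\<lambda>h. h \<bullet> D) = (\<lambda>h. h \<bullet> D')"
    using assms has_derivative_unique unfolding gderiv_def by blast
  then show ?thesis by (simp add: fun_eq_iff vector_eq_ldot)
qed

lemma grad_eq: "GDERIV f x :> D \<Longrightarrow> grad f x = D"
  unfolding grad_def by (blast intro: the_equality gderiv_unique)

text \<open>Riesz representation in coordinates: the values of the derivative on the basis are the
  coordinates of the gradient.\<close>

lemma gderiv_grad:
  assumes "f differentiable (at x)"
  shows "GDERIV f x :> grad f x"
proof -
  obtain f' where f': "(f has_derivative f') (at x)"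
    using assms by (auto simp: differentiable_def)
  then have lin: "linear f'" by (rule has_derivative_linear)
  have "f' = (\<lambda>h. h \<bullet> (\<Sum>b\<in>Basis. f' b *\<^sub>R b))"
  proof
    fix h
    have "f' h = (\<Sum>b\<in>Basis. (h \<bullet> b) * f' b)"
      using linear_sum[OF lin, of "\<lambda>b. (h \<bullet> b) *\<^sub>R b" Basis]
      by (simp add: euclidean_representation linear_scale[OF lin])
    then show "f' h = h \<bullet> (\<Sum>b\<in>Basis. f' b *\<^sub>R b)"
      by (simp add: inner_sum_right mult.commute)
  qed
  then have "GDERIV f x :> (\<Sum>b\<in>Basis. f' b *\<^sub>R b)"
    using f' by (simp add: gderiv_def)
  then show ?thesis using grad_eq by metis
qed

lemma twice_differentiable_finite_avg:
  fixes f :: "nat \<Rightarrow> real^'p \<Rightarrow> real"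
  assumes "\<And>i. i \<in> {1..n} \<Longrightarrow> twice_differentiable (f i)"
  shows "twice_differentiable (finite_avg n f)"
proof -
  let ?g = "\<lambda>x. (1 / real n) *\<^sub>R (\<Sum>i=1..n. grad (f i) x)"
  have gd: "GDERIV (finite_avg n f) x :> ?g x" for x
  proof -
    have "((f i) has_derivative (\<lambda>h. h \<bullet> grad (f i) x)) (at x)" if "i \<in> {1..n}" for i
      using gderiv_grad assms[OF that] unfolding twice_differentiable_def gderiv_def by blast
    then have "(finite_avg n f has_derivative
        (\<lambda>h. (1 / real n) * (\<Sum>i=1..n. h \<bullet> grad (f i) x))) (at x)"
      unfolding finite_avg_def[abs_def]
      by (intro has_derivative_mult_right has_derivative_sum) simp
    then show ?thesis by (simp add: gderiv_def inner_sum_right)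
  qed
  \<comment> \<open>Since \<open>grad\<close> is a definite description, its differentiability is
    read off from this explicit formula.\<close>
  then have "grad (finite_avg n f) = ?g" using grad_eq by blast
  moreover have "?g differentiable (at x)" for x
    using assms unfolding twice_differentiable_def
    by (intro differentiable_scaleR differentiable_const differentiable_sum) auto
  ultimately show ?thesis
    using gd unfolding twice_differentiable_def gderiv_def differentiable_def by metis
qed

text \<open>The Lagrange remainder on the segment from \<open>x\<close> to \<open>x + v\<close> is
  used because second derivatives are only assumed to exist; an integral remainder would ask for
  more regularity.\<close>

lemma second_order_taylor:
  assumes "twice_differentiable f"
  shows "\<exists>y. f (x + v) = f x + v \<bullet> grad f x + 1 / 2 * (v \<bullet> (hessian f y *v v))"
proof -
  let ?l = "\<lambda>t. x + t *\<^sub>R v"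
  \<comment> \<open>For \<open>m\<close> up to 2, \<open>d m\<close> is the derivative of order
    \<open>m\<close> of \<open>f\<close> along the segment.\<close>
  define d :: "nat \<Rightarrow> real \<Rightarrow> real" where
    "d m t = (if m = 0 then f (?l t) else if m = 1 then v \<bullet> grad f (?l t)
      else v \<bullet> (hessian f (?l t) *v v))" for m t
  have l: "(?l has_derivative (\<lambda>h. h *\<^sub>R v)) (at t)" for t
    by (auto intro!: derivative_eq_intros)
  have d0: "((\<lambda>t. f (?l t)) has_real_derivative v \<bullet> grad f (?l t)) (at t)" for t
  proof -
    have "(f has_derivative (\<lambda>h. h \<bullet> grad f (?l t))) (at (?l t))"
      using gderiv_grad assms unfolding twice_differentiable_def gderiv_def by blast
    from has_derivative_compose[OF l this] show ?thesis
      by (simp add: has_field_derivative_def mult_commute_abs)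
  qed
  have d1: "((\<lambda>t. v \<bullet> grad f (?l t)) has_real_derivative v \<bullet> (hessian f (?l t) *v v)) (at t)" for t
  proof -
    have "(grad f has_derivative (\<lambda>h. hessian f (?l t) *v h)) (at (?l t))"
      using assms unfolding twice_differentiable_def hessian_def by (simp add: jacobian_works)
    from has_derivative_inner_right[OF has_derivative_compose[OF l this], of v] show ?thesis
      by (simp add: has_field_derivative_def matrix_vector_mult_scaleR mult_commute_abs)
  qed
  have "\<forall>m t. m < 2 \<and> 0 \<le> t \<and> t \<le> 1 \<longrightarrow> (d m has_real_derivative d (Suc m) t) (at t)"
    using d0 d1 by (auto simp: d_def[abs_def] less_2_cases_iff)
  then obtain t where "d 0 1 = (\<Sum>m<2. d m 0 / fact m * 1 ^ m) + d 2 t / fact 2 * 1 ^ 2"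
    using Maclaurin2[of 1 d "d 0" 2] by auto
  then have "f (x + v) = f x + v \<bullet> grad f x + 1 / 2 * (v \<bullet> (hessian f (?l t) *v v))"
    by (simp add: d_def numeral_2_eq_2)
  then show ?thesis by blast
qed

section \<open>Consequences of the Hessian bounds\<close>

text \<open>Strong convexity bounds \<open>f z\<close> below by a quadratic around \<open>x\<close>,
  and completing the square removes the dependence on \<open>z - x\<close>. The point
  \<open>z\<close> is arbitrary, so no optimality condition enters.\<close>

lemma polyak_lojasiewicz:
  assumes "twice_differentiable f" "0 < \<gamma>" "\<And>y. mat \<gamma> \<preceq> hessian f y"
  shows "2 * \<gamma> * (f x - f z) \<le> (norm (grad f x))\<^sup>2"
proof -
  define v where "v = z - x"
  let ?g = "grad f x"
  obtain y where "f (x + v) = f x + v \<bullet> ?g + 1 / 2 * (v \<bullet> (hessian f y *v v))"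
    using second_order_taylor[OF assms(1)] by blast
  moreover have "\<gamma> * (v \<bullet> v) \<le> v \<bullet> (hessian f y *v v)"
    using loewner_le_inner[OF assms(3), of v y]
    by (simp add: inner_mat_mult_vec power2_norm_eq_inner)
  moreover have "x + v = z" by (simp add: v_def)
  ultimately have "f x - f z \<le> - (v \<bullet> ?g) - \<gamma> / 2 * (v \<bullet> v)" by simp
  then have "2 * \<gamma> * (f x - f z) \<le> 2 * \<gamma> * (- (v \<bullet> ?g) - \<gamma> / 2 * (v \<bullet> v))"
    using assms(2) by (intro mult_left_mono) auto
  also have "\<dots> = (norm ?g)\<^sup>2 - (norm (?g + \<gamma> *\<^sub>R v))\<^sup>2"
    unfolding power2_norm_eq_inner
    by (simp add: inner_add_left inner_add_right inner_commute[of ?g v] algebra_simps)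
  also have "\<dots> \<le> (norm ?g)\<^sup>2" by simp
  finally show ?thesis .
qed

text \<open>The Taylor remainder is at most \<open>a\<^sup>2 * K * (norm p)\<^sup>2 / 2\<close>,
  while the Armijo condition leaves a slack of at least
  \<open>a * (1 - \<beta>) * c * (norm p)\<^sup>2\<close>. The bound on \<open>a * K\<close> says
  that the remainder fits into this slack.\<close>

lemma armijo_small_step:
  assumes F: "twice_differentiable F" "\<And>y. hessian F y \<preceq> mat K"
    and \<beta>: "\<beta> \<le> 1"
    and descent: "p \<bullet> grad F x \<le> - c * (norm p)\<^sup>2"
    and a: "0 \<le> a" "a * K \<le> 2 * c * (1 - \<beta>)"
  shows "armijo F \<beta> x p a"
proof -
  obtain y where y: "F (x + a *\<^sub>R p)
      = F x + a *\<^sub>R p \<bullet> grad F x + 1 / 2 * (a *\<^sub>R p \<bullet> (hessian F y *v (a *\<^sub>R p)))"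
    using second_order_taylor[OF F(1)] by blast
  have "a *\<^sub>R p \<bullet> (hessian F y *v (a *\<^sub>R p)) \<le> K * (norm (a *\<^sub>R p))\<^sup>2"
    using loewner_le_inner[OF F(2)] by (simp only: inner_mat_mult_vec)
  then have "F (x + a *\<^sub>R p) \<le> F x + a * (p \<bullet> grad F x) + 1 / 2 * a * (a * K * (norm p)\<^sup>2)"
    using y by (simp add: power_mult_distrib power2_eq_square mult_ac)
  moreover have "1 / 2 * a * (a * K * (norm p)\<^sup>2) \<le> 1 / 2 * a * (2 * c * (1 - \<beta>) * (norm p)\<^sup>2)"
    using a by (intro mult_left_mono mult_right_mono) auto
  moreover have "a * (1 - \<beta>) * (p \<bullet> grad F x) \<le> a * (1 - \<beta>) * (- c * (norm p)\<^sup>2)"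
    using a(1) \<beta> descent by (intro mult_left_mono) auto
  ultimately show ?thesis unfolding armijo_def by (simp add: algebra_simps)
qed

section \<open>The sub-sampled ridge Hessian\<close>

lemma ridge_hessian_bounds:
  fixes f :: "nat \<Rightarrow> real^'p \<Rightarrow> real"
  assumes S: "finite S" "S \<noteq> {}"
    and hess: "\<And>j. j \<in> S \<Longrightarrow> 0 \<preceq> hessian (f j) x \<and> hessian (f j) x \<preceq> mat (K j)"
  shows "transpose (ridge_hessian f lam S x) = ridge_hessian f lam S x"
    and "lam * (norm v)\<^sup>2 \<le> v \<bullet> (ridge_hessian f lam S x *v v)"
    and "v \<bullet> (ridge_hessian f lam S x *v v) \<le> ((\<Sum>j\<in>S. K j) / real (card S) + lam) * (norm v)\<^sup>2"
proof -
  \<comment> \<open>Symmetry is part of the relation \<open>0 \<preceq> hessian (f j) x\<close>, so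
    equality of mixed partial derivatives is not invoked.\<close>
  have "hessian (f j) x $ a $ b = hessian (f j) x $ b $ a" if "j \<in> S" for j a b
    using hess[OF that] by (auto simp: loewner_le_def transpose_def vec_eq_iff)
  then show "transpose (ridge_hessian f lam S x) = ridge_hessian f lam S x"
    by (auto simp: ridge_hessian_def subsampled_hessian_def transpose_def vec_eq_iff mat_def
        intro!: sum.cong)
  have "(\<Sum>j\<in>S. hessian (f j) x) *v v = (\<Sum>j\<in>S. hessian (f j) x *v v)"
    using S(1) by (induction S) (simp_all add: matrix_vector_mult_add_rdistrib)
  then have form: "v \<bullet> (ridge_hessian f lam S x *v v)
      = (\<Sum>j\<in>S. v \<bullet> (hessian (f j) x *v v)) / real (card S) + lam * (norm v)\<^sup>2"
    by (simp add: ridge_hessian_def subsampled_hessian_def matrix_vector_mult_add_rdistrib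
        inner_add_right inner_mat_mult_vec scaleR_matrix_vector_assoc[symmetric] inner_sum_right)
  have "0 \<le> (\<Sum>j\<in>S. v \<bullet> (hessian (f j) x *v v))"
    using hess loewner_le_inner[of 0 _ v] by (intro sum_nonneg) simp
  then show "lam * (norm v)\<^sup>2 \<le> v \<bullet> (ridge_hessian f lam S x *v v)"
    by (simp add: form)
  have "(\<Sum>j\<in>S. v \<bullet> (hessian (f j) x *v v)) \<le> (\<Sum>j\<in>S. K j * (norm v)\<^sup>2)"
    using hess loewner_le_inner[of _ "mat _" v] by (intro sum_mono) (simp add: inner_mat_mult_vec)
  then have "(\<Sum>j\<in>S. v \<bullet> (hessian (f j) x *v v)) / real (card S)
      \<le> (\<Sum>j\<in>S. K j * (norm v)\<^sup>2) / real (card S)"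
    by (intro divide_right_mono) auto
  then show "v \<bullet> (ridge_hessian f lam S x *v v)
      \<le> ((\<Sum>j\<in>S. K j) / real (card S) + lam) * (norm v)\<^sup>2"
    by (simp add: form sum_distrib_right[symmetric] algebra_simps)
qed

section \<open>Decrease and step size in one iteration\<close>

theorem theorem5:
  fixes f :: "nat \<Rightarrow> real^'p \<Rightarrow> real" and F :: "real^'p \<Rightarrow> real"
    and Ki :: "nat \<Rightarrow> real" and K \<theta>1 \<theta>2 \<beta> \<alpha>max lam Khat \<alpha> :: real
    and n s :: nat and S :: "nat set" and x p x' :: "real^'p"
  defines "F \<equiv> finite_avg n f"
    and "Khat \<equiv> avg_largest n Ki s"
  assumes f_diff: "\<And>i. i \<in> {1..n} \<Longrightarrow> twice_differentiable (f i)"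
    and Ki_pos: "\<And>i. i \<in> {1..n} \<Longrightarrow> 0 < Ki i"
    and f_hess: "\<And>i y. i \<in> {1..n} \<Longrightarrow> 0 \<preceq> hessian (f i) y \<and> hessian (f i) y \<preceq> mat (Ki i)"
    and K_pos: "0 < K"
    and F_hess: "\<And>y. hessian F y \<preceq> mat K"
    and \<theta>2: "0 < \<theta>2" "\<theta>2 < 1"
    and \<beta>: "0 < \<beta>" "\<beta> < 1"
    and \<alpha>max: "1 \<le> \<alpha>max"
    and lam: "0 < lam"
    and s: "1 \<le> s" "s \<le> n"
    and sample: "S \<in> set_pmf (sample_without_replacement n s)"
    and iter: "ssn_iteration n f lam \<theta>1 \<theta>2 \<beta> \<alpha>max S x p \<alpha> x'"
    and \<theta>1: "0 \<le> \<theta>1" "\<theta>1 \<le> 1 / 2 * sqrt (lam / (Khat + lam))"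
  shows "F x' \<le> F x - \<alpha> * \<beta> / (2 * (Khat + lam)) * (norm (grad F x))\<^sup>2
    \<and> (\<forall>\<gamma> xstar. 0 < \<gamma> \<and> \<gamma> \<le> K \<and> (\<forall>y. mat \<gamma> \<preceq> hessian F y) \<and> is_arg_min F (\<lambda>_. True) xstar \<longrightarrow>
          F x' - F xstar \<le> (1 - \<alpha> * \<beta> * \<gamma> / (Khat + lam)) * (F x - F xstar))
    \<and> \<alpha> \<ge> min \<alpha>max (2 * (1 - \<theta>2) * (1 - \<beta>) * lam / K)"
proof -
  \<comment> \<open>The support of \<open>pmf_of_set\<close> is known only for a finite nonempty
    set; \<open>s \<le> n\<close> supplies nonemptiness.\<close>
  have "finite {S. S \<subseteq> {1..n} \<and> card S = s}" by simp
  moreover have "{S. S \<subseteq> {1..n} \<and> card S = s} \<noteq> {}"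
    using obtain_subset_with_card_n[of s "{1..n}"] s by auto
  ultimately have S: "S \<subseteq> {1..n}" "card S = s"
    using sample by (auto simp: sample_without_replacement_def)
  have finS: "finite S" "S \<noteq> {}" using S s finite_subset by auto
  define M where "M = Khat + lam"
  define g where "g = grad F x"
  define A where "A = ridge_hessian f lam S x"
  have hess_S: "0 \<preceq> hessian (f j) x \<and> hessian (f j) x \<preceq> mat (Ki j)" if "j \<in> S" for j
    using f_hess that S by blast
  have avg: "(\<Sum>j\<in>S. Ki j) / real (card S) \<le> Khat"
    using avg_le_avg_largest[OF S(1), of Ki] S(2) by (simp add: Khat_def)
  have "0 \<le> (\<Sum>j\<in>S. Ki j) / real (card S)"
    using Ki_pos S by (intro divide_nonneg_nonneg sum_nonneg) (meson less_imp_le subsetD, simp)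
  then have M: "0 < M" using avg lam by (simp add: M_def)
  have sym: "transpose A = A"
    unfolding A_def by (rule ridge_hessian_bounds[OF finS hess_S])
  have lower: "lam * (norm v)\<^sup>2 \<le> v \<bullet> (A *v v)" for v
    unfolding A_def by (rule ridge_hessian_bounds[OF finS hess_S])
  have upper: "v \<bullet> (A *v v) \<le> M * (norm v)\<^sup>2" for v
  proof -
    have "v \<bullet> (A *v v) \<le> ((\<Sum>j\<in>S. Ki j) / real (card S) + lam) * (norm v)\<^sup>2"
      unfolding A_def by (rule ridge_hessian_bounds[OF finS hess_S])
    also have "\<dots> \<le> M * (norm v)\<^sup>2"
      using avg unfolding M_def by (intro mult_right_mono) auto
    finally show ?thesis .
  qed
  have it: "norm (A *v p + g) \<le> \<theta>1 * norm g" "p \<bullet> g \<le> - (1 - \<theta>2) * (p \<bullet> (A *v p))"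
      "armijo F \<beta> x p \<alpha>" "\<And>a. a \<le> \<alpha>max \<Longrightarrow> armijo F \<beta> x p a \<Longrightarrow> a \<le> \<alpha>" "x' = x + \<alpha> *\<^sub>R p"
    using iter by (simp_all add: ssn_iteration_def inexact_newton_direction_def armijo_step_def
      A_def g_def F_def)
  have tdF: "twice_differentiable F"
    unfolding F_def by (rule twice_differentiable_finite_avg[OF f_diff])
  \<comment> \<open>The second direction condition measures descent by \<open>norm p\<close>, as the
    step-size bound requires; the residual condition measures it by \<open>norm g\<close>.\<close>
  have "p \<bullet> g \<le> - (1 - \<theta>2) * (lam * (norm p)\<^sup>2)"
    using it(2) mult_left_mono_neg[OF lower[of p], of "- (1 - \<theta>2)"] \<theta>2 by linarith
  then have pg: "p \<bullet> grad F x \<le> - ((1 - \<theta>2) * lam) * (norm p)\<^sup>2"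
    by (simp add: g_def algebra_simps)
  \<comment> \<open>The minimum is essential: the step never exceeds \<open>\<alpha>max\<close>, so
    the fraction alone cannot bound it below when it is larger than the cap.\<close>
  define a where "a = min \<alpha>max (2 * (1 - \<theta>2) * (1 - \<beta>) * lam / K)"
  have a0: "0 \<le> a" using \<alpha>max \<theta>2 \<beta> lam K_pos by (simp add: a_def)
  have "a \<le> 2 * (1 - \<theta>2) * (1 - \<beta>) * lam / K" by (simp add: a_def)
  then have "a * K \<le> 2 * ((1 - \<theta>2) * lam) * (1 - \<beta>)"
    using K_pos by (simp add: pos_le_divide_eq mult_ac)
  then have "armijo F \<beta> x p a"
    using armijo_small_step[OF tdF F_hess _ pg a0] \<beta> by simp
  \<comment> \<open>Maximality of \<open>\<alpha>\<close> turns one admissible step into a lower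
    bound. It also yields \<open>0 \<le> \<alpha>\<close>, which the multiplication of the descent
    inequality by \<open>\<alpha> * \<beta>\<close> relies on.\<close>
  then have step: "a \<le> \<alpha>" using it(4) by (simp add: a_def)
  then have \<alpha>0: "0 \<le> \<alpha>" using a0 by simp
  have "p \<bullet> g \<le> - (norm g)\<^sup>2 / (2 * M)"
    using inexact_newton_descent[OF sym lower upper lam M it(1)] \<theta>1 by (simp add: M_def)
  then have "\<alpha> * \<beta> * (p \<bullet> g) \<le> \<alpha> * \<beta> * (- (norm g)\<^sup>2 / (2 * M))"
    using \<alpha>0 \<beta> by (intro mult_left_mono) auto
  then have dec: "F x' \<le> F x - \<alpha> * \<beta> / (2 * M) * (norm g)\<^sup>2"
    using it(3,5) by (simp add: armijo_def g_def)
  \<comment> \<open>The contraction holds relative to any point \<open>z\<close>; the minimizer is a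
    special case.\<close>
  have "F x' - F z \<le> (1 - \<alpha> * \<beta> * \<gamma> / M) * (F x - F z)"
    if "0 < \<gamma>" "\<And>y. mat \<gamma> \<preceq> hessian F y" for \<gamma> z
  proof -
    have "\<alpha> * \<beta> / (2 * M) * (2 * \<gamma> * (F x - F z)) \<le> \<alpha> * \<beta> / (2 * M) * (norm g)\<^sup>2"
      using polyak_lojasiewicz[OF tdF that] \<alpha>0 \<beta> M unfolding g_def
      by (intro mult_left_mono) auto
    then have "F x' \<le> F x - \<alpha> * \<beta> / (2 * M) * (2 * \<gamma> * (F x - F z))" using dec by simp
    then show ?thesis using M by (simp add: field_simps)
  qed
  then show ?thesis using dec step unfolding M_def g_def a_def by blast
qed

end
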